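(* Each of the following quaternary sums is universal over $\mathbb{Z}$: $2p_5+2p_5+p_8+p_8$, $p_8+p_8+p_8+p_8$, $3p_4+3p_4+p_8+p_8$, $6p_3+3p_4+2p_5+p_8$, $3p_3+p_5+2p_5+2p_5$, $3p_3+p_5+p_8+p_8$, $3p_4+p_5+p_5+p_8$, $6p_3+p_5+p_5+2p_5$, $p_5+p_5+p_5+4p_5$, $p_5+p_5+p_5+2p_8$, $p_3+p_3+2p_4+3p_5$, $p_3+p_3+4p_3+3p_5$, $p_4+2p_5+3p_5+4p_5$, $p_4+2p_5+3p_5+2p_8$, $2p_5+2p_5+2p_5+p_8$, $2p_5+p_8+p_8+p_8$.
   Context: For an integer $m\ge 3$ and $x\in\mathbb{Z}$, the generalized $m$-gonal number is $p_m(x)=\frac{(m-2)x^2-(m-4)x}{2}$; thus $p_3(x)=x(x+1)/2$, $p_4(x)=x^2$, $p_5(x)=x(3x-1)/2$, $p_8(x)=x(3x-2)$. For positive integers $a,b,c,d$ and $r,s,t,u\ge 3$, the notation $ap_r+bp_s+cp_t+dp_u$ denotes the function $(h,l,m,n)\mapsto ap_r(h)+bp_s(l)+cp_t(m)+dp_u(n)$ on $\mathbb{Z}^4$ (four independent integer variables). Such a sum is called universal over $\mathbb{Z}$ if its set of values $\{ap_r(h)+bp_s(l)+cp_t(m)+dp_u(n): h,l,m,n\in\mathbb{Z}\}$ equals $\mathbb{N}_0=\{0,1,2,\dots\}$. *)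

theory Defs
  imports Main
begin

text \<open>Generalized m-gonal number p_m(x) = ((m-2)x^2 - (m-4)x)/2 for x in Z.
  The numerator is always even, so integer division is exact.\<close>
definition polyg :: "int \<Rightarrow> int \<Rightarrow> int" where
  "polyg m x = ((m - 2) * x^2 - (m - 4) * x) div 2"

definition universal4 ::
  "int \<Rightarrow> int \<Rightarrow> int \<Rightarrow> int \<Rightarrow> int \<Rightarrow> int \<Rightarrow> int \<Rightarrow> int \<Rightarrow> bool" where
  "universal4 a r b s c t d u \<longleftrightarrow>
     {a * polyg r h + b * polyg s l + c * polyg t m + d * polyg u n | h l m n. True}
       = {k. 0 \<le> k}"

end

theory Submission
  imports Defs "HOL-Computational_Algebra.Primes"
begin

text \<open>
  Completing squares turns each of the sixteen claims into a statement about representing a number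
  \<open>N\<close> in an arithmetic progression as a sum of four squares, where some of the squares must be
  coprime to 2 or to 3. The parities are mostly forced by \<open>N\<close> modulo 8, so everything rests on
  a refinement of Lagrange's theorem: every \<open>N \<ge> 2\<close> is a sum of four squares at most two of which
  are divisible by 3 (hence none if \<open>N \<equiv> 1\<close> modulo 3). If three of the squares, not all zero, are
  divisible by 3, then they are replaced by coprime ones by means of the reflection
  \<open>(x, y, z) \<mapsto> (x, y, z) - (2 s / 3) (1, 1, 1)\<close> with \<open>s = x + y + z\<close>: once the signs are chosen
  suitably, it lowers the common power of 3 by one and makes all three entries exactly divisible by it.
  If all three are zero, then \<open>N = a\<^sup>2\<close> has another representation, obtained by squaring a
  quaternion of norm \<open>a\<close>.
\<close>

subsection \<open>Lagrange's theorem\<close>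

text \<open>Pigeonhole: for odd \<open>p = 2 * h + 1\<close>, squaring is injective modulo
  \<open>p\<close> on \<open>{0..h}\<close>, so the residues of \<open>x\<^sup>2\<close> and of
  \<open>- 1 - y\<^sup>2\<close> form two sets of size \<open>h + 1\<close>, which must meet among
  the \<open>p\<close> residues. The small range of \<open>x\<close> and \<open>y\<close> also gives
  \<open>m < p\<close>.\<close>

lemma prime_dvd_sum_two_squares_plus_one:
  fixes p :: int
  assumes "prime p"
  shows "\<exists>x y m. x\<^sup>2 + y\<^sup>2 + 1 = m * p \<and> 0 < m \<and> m < p"
proof (cases "p = 2")
  case True
  have "(1::int)\<^sup>2 + 0\<^sup>2 + 1 = 1 * p \<and> (0::int) < 1 \<and> 1 < p" using True by simp
  then show ?thesis by blast
next
  case False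
  have p2: "p > 2" using prime_ge_2_int[OF assms] False by simp
  define h where "h = p div 2"
  have "odd p" using assms p2 by (simp add: prime_odd_int)
  then have h: "p = 2 * h + 1" by (simp add: h_def)
  have inj: "x = y" if "0 \<le> x" "x \<le> h" "0 \<le> y" "y \<le> h" "p dvd x\<^sup>2 - y\<^sup>2" for x y
  proof -
    have "p dvd (x - y) * (x + y)" using that(5) by (simp add: power2_eq_square algebra_simps)
    then have "p dvd x - y \<or> p dvd x + y" using assms prime_dvd_mult_iff by blast
    moreover have "\<bar>x - y\<bar> < p" "\<bar>x + y\<bar> < p" using that h by auto
    ultimately have "x - y = 0 \<or> x + y = 0"
      using dvd_imp_le_int[of "x - y" p] dvd_imp_le_int[of "x + y" p] p2 by auto
    then show ?thesis using that by auto
  qed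
  let ?f = "\<lambda>x::int. x\<^sup>2 mod p" and ?g = "\<lambda>y::int. (- 1 - y\<^sup>2) mod p"
  have f: "inj_on ?f {0..h}"
    by (rule inj_onI) (auto intro!: inj simp: mod_eq_dvd_iff)
  have g: "inj_on ?g {0..h}"
  proof (rule inj_onI)
    fix x y assume *: "x \<in> {0..h}" "y \<in> {0..h}" "?g x = ?g y"
    then have "p dvd y\<^sup>2 - x\<^sup>2" by (simp add: mod_eq_dvd_iff)
    then show "x = y" using inj[of y x] * by auto
  qed
  have "?f ` {0..h} \<inter> ?g ` {0..h} \<noteq> {}"
  proof
    assume "?f ` {0..h} \<inter> ?g ` {0..h} = {}"
    then have "card (?f ` {0..h} \<union> ?g ` {0..h}) = nat (h + 1) + nat (h + 1)"
      by (subst card_Un_disjoint) (auto simp: card_image f g)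
    moreover have "?f ` {0..h} \<union> ?g ` {0..h} \<subseteq> {0..<p}" using p2 by auto
    then have "card (?f ` {0..h} \<union> ?g ` {0..h}) \<le> card {0..<p}" by (intro card_mono) auto
    ultimately show False using h p2 by simp
  qed
  then obtain x y where xy: "x \<in> {0..h}" "y \<in> {0..h}" "?f x = ?g y" by blast
  then have "p dvd x\<^sup>2 - (- 1 - y\<^sup>2)" by (simp only: mod_eq_dvd_iff)
  then have "p dvd x\<^sup>2 + y\<^sup>2 + 1" by (simp add: algebra_simps)
  then obtain m where m: "x\<^sup>2 + y\<^sup>2 + 1 = m * p" by (metis dvdE mult.commute)
  have "x\<^sup>2 \<le> h\<^sup>2" "y\<^sup>2 \<le> h\<^sup>2" using xy by (auto intro: power_mono)
  moreover have "p * p = 4 * h\<^sup>2 + 4 * h + 1" by (simp add: h power2_eq_square algebra_simps)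
  ultimately have "m * p < p * p" using m h p2 by (smt (verit) zero_le_power2)
  then have "m < p" using p2 by simp
  moreover have "0 < m * p" using m by (smt (verit) zero_le_power2)
  then have "0 < m" using p2 by (simp add: zero_less_mult_iff)
  ultimately show ?thesis using m by blast
qed

definition sum_four_squares :: "int \<Rightarrow> bool" where
  "sum_four_squares n \<longleftrightarrow> (\<exists>a b c d. n = a\<^sup>2 + b\<^sup>2 + c\<^sup>2 + d\<^sup>2)"

text \<open>Multiplicativity of the quaternion norm. The last three terms vanish when the two
  quadruples agree, so they are divisible by \<open>m\<close> when the quadruples agree modulo
  \<open>m\<close>.\<close>

lemma euler_four_squares:
  fixes x1 :: "'a::comm_ring_1"
  shows "(x1\<^sup>2 + x2\<^sup>2 + x3\<^sup>2 + x4\<^sup>2) * (y1\<^sup>2 + y2\<^sup>2 + y3\<^sup>2 + y4\<^sup>2) =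
    (x1 * y1 + x2 * y2 + x3 * y3 + x4 * y4)\<^sup>2 + (x1 * y2 - x2 * y1 + x3 * y4 - x4 * y3)\<^sup>2 +
    (x1 * y3 - x3 * y1 + x4 * y2 - x2 * y4)\<^sup>2 + (x1 * y4 - x4 * y1 + x2 * y3 - x3 * y2)\<^sup>2"
  by (simp add: power2_eq_square algebra_simps)

lemma sum_four_squares_mult:
  "sum_four_squares m \<Longrightarrow> sum_four_squares n \<Longrightarrow> sum_four_squares (m * n)"
  unfolding sum_four_squares_def using euler_four_squares by metis

lemma ex_least_abs_residue:
  fixes m x :: int
  assumes "0 < m"
  shows "\<exists>k. 2 * \<bar>x - k * m\<bar> \<le> m"
proof (cases "2 * (x mod m) \<le> m")
  case True
  have "x - (x div m) * m = x mod m" by (simp add: minus_div_mult_eq_mod)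
  then show ?thesis using True assms by (intro exI[of _ "x div m"]) simp
next
  case False
  have "x - (x div m + 1) * m = x mod m - m"
    by (simp add: algebra_simps minus_div_mult_eq_mod minus_mult_div_eq_mod)
  moreover have "x mod m < m" using assms by simp
  ultimately have "2 * \<bar>x - (x div m + 1) * m\<bar> \<le> m" using False by (smt (verit))
  then show ?thesis ..
qed

text \<open>Least absolute residues modulo \<open>m\<close> have square sum \<open>m * r\<close>
  with \<open>r \<le> m\<close>. In Euler's product of \<open>m * p\<close> and \<open>m * r\<close>
  all four terms are divisible by \<open>m\<close>, and dividing by \<open>m\<^sup>2\<close> leaves
  \<open>r * p\<close>. The extremes \<open>r = 0\<close> and \<open>r = m\<close> would force
  \<open>m dvd p\<close>.\<close>

lemma four_squares_descent:
  fixes p m :: int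
  assumes p: "prime p" and m: "1 < m" "m < p" and mp: "sum_four_squares (m * p)"
  shows "\<exists>r. 0 < r \<and> r < m \<and> sum_four_squares (r * p)"
proof -
  obtain x1 x2 x3 x4 where x: "m * p = x1\<^sup>2 + x2\<^sup>2 + x3\<^sup>2 + x4\<^sup>2"
    using mp unfolding sum_four_squares_def by blast
  obtain k1 k2 k3 k4 where k: "2 * \<bar>x1 - k1 * m\<bar> \<le> m" "2 * \<bar>x2 - k2 * m\<bar> \<le> m"
      "2 * \<bar>x3 - k3 * m\<bar> \<le> m" "2 * \<bar>x4 - k4 * m\<bar> \<le> m"
    using ex_least_abs_residue m by (metis less_trans zero_less_one)
  define y1 y2 y3 y4 where y: "y1 = x1 - k1 * m" "y2 = x2 - k2 * m" "y3 = x3 - k3 * m" "y4 = x4 - k4 * m"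
  \<comment> \<open>The square sum of the residues divided by \<open>m\<close>, expanded so that no
    division occurs.\<close>
  define r where "r = p - 2 * (x1 * k1 + x2 * k2 + x3 * k3 + x4 * k4) + m * (k1\<^sup>2 + k2\<^sup>2 + k3\<^sup>2 + k4\<^sup>2)"
  have r: "m * r = y1\<^sup>2 + y2\<^sup>2 + y3\<^sup>2 + y4\<^sup>2"
    using x by (simp add: r_def y power2_eq_square algebra_simps)
  have not_dvd: "\<not> m dvd p"
    using p m unfolding prime_int_iff by (metis less_irrefl less_le_not_le order.strict_trans zero_less_one)
  have sq: "4 * z\<^sup>2 \<le> m\<^sup>2 \<and> (4 * z\<^sup>2 = m\<^sup>2 \<longrightarrow> 2 * \<bar>z\<bar> = m)" if "2 * \<bar>z\<bar> \<le> m" for z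
  proof -
    have "(2 * \<bar>z\<bar>)\<^sup>2 \<le> m\<^sup>2" using that by (intro power_mono) auto
    moreover have "2 * \<bar>z\<bar> = m" if "(2 * \<bar>z\<bar>)\<^sup>2 = m\<^sup>2" using that m power2_eq_imp_eq[of "2 * \<bar>z\<bar>" m] by simp
    ultimately show ?thesis by (simp add: power_mult_distrib)
  qed
  note sqs = sq[OF k(1)[folded y]] sq[OF k(2)[folded y]] sq[OF k(3)[folded y]] sq[OF k(4)[folded y]]
  have "m * r \<le> m * m" using sqs r by (simp add: power2_eq_square)
  then have "r \<le> m" using m by simp
  have "0 \<le> m * r" using r by simp
  then have "0 \<le> r" using m by (simp add: zero_le_mult_iff)
  have "r \<noteq> 0"
  proof
    assume "r = 0"
    then have "y1 = 0" "y2 = 0" "y3 = 0" "y4 = 0"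
      using r by (simp_all add: add_nonneg_eq_0_iff)
    then have "x1 = k1 * m" "x2 = k2 * m" "x3 = k3 * m" "x4 = k4 * m" by (simp_all add: y)
    then have "m * p = m * (m * (k1\<^sup>2 + k2\<^sup>2 + k3\<^sup>2 + k4\<^sup>2))"
      using x by (simp add: power2_eq_square algebra_simps)
    then show False using not_dvd m by simp
  qed
  moreover have "r \<noteq> m"
  proof
    assume "r = m"
    then have "4 * y1\<^sup>2 = m\<^sup>2 \<and> 4 * y2\<^sup>2 = m\<^sup>2 \<and> 4 * y3\<^sup>2 = m\<^sup>2 \<and> 4 * y4\<^sup>2 = m\<^sup>2"
      using r sqs power2_eq_square[of m] by auto
    then have e: "2 * \<bar>y1\<bar> = m" "2 * \<bar>y2\<bar> = m" "2 * \<bar>y3\<bar> = m" "2 * \<bar>y4\<bar> = m"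
      using sqs by auto
    \<comment> \<open>Each entry is now \<open>m / 2\<close> plus a multiple of \<open>m\<close>, so
      its square is \<open>m\<^sup>2 / 4\<close> modulo \<open>m\<^sup>2\<close>, and the four
      squares add up to a multiple of \<open>m\<^sup>2\<close>.\<close>
    have ex: "\<exists>j. z\<^sup>2 = \<bar>y1\<bar>\<^sup>2 + m * m * j" if "2 * \<bar>z - k * m\<bar> = m" for z k
    proof -
      have "z = \<bar>y1\<bar> + k * m \<or> z = \<bar>y1\<bar> + (k - 1) * m"
        using that e by (auto simp: abs_if algebra_simps split: if_splits)
      moreover have "(\<bar>y1\<bar> + i * m)\<^sup>2 = \<bar>y1\<bar>\<^sup>2 + m * m * (i + i\<^sup>2)" for i
        using arg_cong[OF e(1), of "\<lambda>u. u * (i * m)"] by (simp add: power2_eq_square algebra_simps)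
      ultimately show ?thesis by blast
    qed
    obtain j1 j2 j3 j4 where "x1\<^sup>2 = \<bar>y1\<bar>\<^sup>2 + m * m * j1" "x2\<^sup>2 = \<bar>y1\<bar>\<^sup>2 + m * m * j2"
        "x3\<^sup>2 = \<bar>y1\<bar>\<^sup>2 + m * m * j3" "x4\<^sup>2 = \<bar>y1\<bar>\<^sup>2 + m * m * j4"
      using ex[OF e(1)[unfolded y]] ex[OF e(2)[unfolded y]] ex[OF e(3)[unfolded y]]
        ex[OF e(4)[unfolded y]] by blast
    then have "m * p = 4 * \<bar>y1\<bar>\<^sup>2 + m * m * (j1 + j2 + j3 + j4)" using x by (simp add: algebra_simps)
    also have "4 * \<bar>y1\<bar>\<^sup>2 = m * m" using arg_cong[OF e(1), of "\<lambda>u. u\<^sup>2"] by (simp add: power2_eq_square)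
    finally have "m * p = m * (m * (1 + j1 + j2 + j3 + j4))" by (simp add: algebra_simps)
    then show False using not_dvd m by simp
  qed
  ultimately have "0 < r" "r < m" using \<open>0 \<le> r\<close> \<open>r \<le> m\<close> by auto
  \<comment> \<open>The four terms of Euler's identity divided by \<open>m\<close>, after
    substituting \<open>y1 = x1 - k1 * m\<close> and its analogues.\<close>
  define A where "A = p - (x1 * k1 + x2 * k2 + x3 * k3 + x4 * k4)"
  define B where "B = - x1 * k2 + x2 * k1 - x3 * k4 + x4 * k3"
  define C where "C = - x1 * k3 + x3 * k1 - x4 * k2 + x2 * k4"
  define D where "D = - x1 * k4 + x4 * k1 - x2 * k3 + x3 * k2"
  have "x1 * y1 + x2 * y2 + x3 * y3 + x4 * y4 = m * A"
    using x by (simp add: A_def y power2_eq_square algebra_simps)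
  moreover have "x1 * y2 - x2 * y1 + x3 * y4 - x4 * y3 = m * B"
    "x1 * y3 - x3 * y1 + x4 * y2 - x2 * y4 = m * C"
    "x1 * y4 - x4 * y1 + x2 * y3 - x3 * y2 = m * D"
    by (simp_all add: B_def C_def D_def y algebra_simps)
  ultimately have "(m * p) * (m * r) = (m * A)\<^sup>2 + (m * B)\<^sup>2 + (m * C)\<^sup>2 + (m * D)\<^sup>2"
    unfolding x r euler_four_squares by simp
  then have "m\<^sup>2 * (r * p) = m\<^sup>2 * (A\<^sup>2 + B\<^sup>2 + C\<^sup>2 + D\<^sup>2)"
    by (simp add: power2_eq_square algebra_simps)
  then have "r * p = A\<^sup>2 + B\<^sup>2 + C\<^sup>2 + D\<^sup>2" using m by simp
  then show ?thesis
    using \<open>0 < r\<close> \<open>r < m\<close> unfolding sum_four_squares_def by blast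
qed

lemma sum_four_squares_prime:
  fixes p :: int
  assumes "prime p"
  shows "sum_four_squares p"
proof -
  have "sum_four_squares p" if "0 < m" "m < p" "sum_four_squares (m * p)" for m
    using that
  proof (induction "nat m" arbitrary: m rule: less_induct)
    case less
    show ?case
    proof (cases "m = 1")
      case False
      then obtain r where "0 < r" "r < m" "sum_four_squares (r * p)"
        using four_squares_descent[OF assms _ less.prems(2,3)] less.prems(1) by auto
      then show ?thesis using less.hyps[of r] less.prems by simp
    qed (use less.prems in simp)
  qed
  moreover obtain x y m where m: "x\<^sup>2 + y\<^sup>2 + 1 = m * p" "0 < m" "m < p"
    using prime_dvd_sum_two_squares_plus_one[OF assms] by blast
  have "m * p = x\<^sup>2 + y\<^sup>2 + 1\<^sup>2 + 0\<^sup>2" using m by simp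
  then have "sum_four_squares (m * p)" unfolding sum_four_squares_def by blast
  ultimately show ?thesis using m by blast
qed

theorem lagrange_four_squares:
  assumes "0 \<le> n"
  shows "sum_four_squares n"
proof -
  have "sum_four_squares (int k)" for k
  proof (induction k rule: less_induct)
    case (less k)
    have triv: "sum_four_squares 0" "sum_four_squares 1"
      unfolding sum_four_squares_def by (rule exI[of _ 0] exI[of _ 1], simp)+
    show ?case
    proof (cases "k \<le> 1")
      case True
      then show ?thesis using triv by (cases k) auto
    next
      case False
      then obtain p where p: "prime p" "p dvd k" using prime_factor_nat[of k] by auto
      then obtain j where j: "k = p * j" by blast
      then have "j < k" using False prime_gt_1_nat[OF p(1)] by (cases "j = 0") auto
      then have "sum_four_squares (int p * int j)"
        using less.IH[of j] p(1) by (intro sum_four_squares_mult[OF sum_four_squares_prime]) auto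
      then show ?thesis by (simp add: j)
    qed
  qed
  then show ?thesis using assms by (metis nonneg_int_cases)
qed

subsection \<open>Squares coprime to 3\<close>

lemma square_mod_3:
  fixes x :: int
  shows "x\<^sup>2 mod 3 = (if 3 dvd x then 0 else 1)"
proof -
  have "x mod 3 = 0 \<or> x mod 3 = 1 \<or> x mod 3 = 2" by presburger
  then show ?thesis by (auto simp: power2_eq_square mod_mult_eq[symmetric, of x x] dvd_eq_mod_eq_0)
qed

text \<open>Three times the reflection: every new entry, such as \<open>3 * x' - 2 * s\<close>, is
  congruent to \<open>s = x' + y' + z'\<close> modulo 3, so one condition on the sum settles all
  three.\<close>

lemma nine_mult_three_squares_step:
  fixes x y z :: int
  assumes "\<not> (3 dvd x \<and> 3 dvd y \<and> 3 dvd z)"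
  shows "\<exists>u v w. \<not> 3 dvd u \<and> \<not> 3 dvd v \<and> \<not> 3 dvd w \<and>
           9 * (x\<^sup>2 + y\<^sup>2 + z\<^sup>2) = u\<^sup>2 + v\<^sup>2 + w\<^sup>2"
proof -
  \<comment> \<open>If all four signed sums were divisible by 3, so would be their differences
    \<open>2 * x\<close>, \<open>2 * y\<close> and \<open>2 * z\<close>.\<close>
  have "\<not> 3 dvd x + y + z \<or> \<not> 3 dvd - x + y + z \<or> \<not> 3 dvd x - y + z \<or> \<not> 3 dvd x + y - z"
    using assms by presburger
  then obtain x' y' z' where s: "\<not> 3 dvd x' + y' + z'"
      and eq: "x'\<^sup>2 = x\<^sup>2" "y'\<^sup>2 = y\<^sup>2" "z'\<^sup>2 = z\<^sup>2"
    by (smt (verit) power2_minus)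
  let ?s = "2 * (x' + y' + z')"
  have "9 * (x'\<^sup>2 + y'\<^sup>2 + z'\<^sup>2) = (3 * x' - ?s)\<^sup>2 + (3 * y' - ?s)\<^sup>2 + (3 * z' - ?s)\<^sup>2"
    by (simp add: power2_eq_square algebra_simps)
  moreover have "\<not> 3 dvd 3 * x' - ?s" "\<not> 3 dvd 3 * y' - ?s" "\<not> 3 dvd 3 * z' - ?s"
    using s by presburger+
  ultimately show ?thesis unfolding eq by blast
qed

text \<open>The factor 9 in the claim drives the induction: if all entries are divisible by 3, the
  induction hypothesis rewrites their own square sum with entries coprime to 3, and the single step
  then absorbs the remaining 9.\<close>

lemma nine_mult_three_squares:
  fixes x y z :: int
  assumes "x \<noteq> 0 \<or> y \<noteq> 0 \<or> z \<noteq> 0"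
  shows "\<exists>u v w. \<not> 3 dvd u \<and> \<not> 3 dvd v \<and> \<not> 3 dvd w \<and>
           9 * (x\<^sup>2 + y\<^sup>2 + z\<^sup>2) = u\<^sup>2 + v\<^sup>2 + w\<^sup>2"
  using assms
proof (induction "nat (\<bar>x\<bar> + \<bar>y\<bar> + \<bar>z\<bar>)" arbitrary: x y z rule: less_induct)
  case less
  show ?case
  proof (cases "3 dvd x \<and> 3 dvd y \<and> 3 dvd z")
    case False
    then show ?thesis by (rule nine_mult_three_squares_step)
  next
    case True
    then obtain x' y' z' where eq: "x = 3 * x'" "y = 3 * y'" "z = 3 * z'" by (auto elim!: dvdE)
    then have "nat (\<bar>x'\<bar> + \<bar>y'\<bar> + \<bar>z'\<bar>) < nat (\<bar>x\<bar> + \<bar>y\<bar> + \<bar>z\<bar>)" "x' \<noteq> 0 \<or> y' \<noteq> 0 \<or> z' \<noteq> 0"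
      using less.prems by auto
    then obtain u v w where "\<not> 3 dvd u"
        and "9 * (x'\<^sup>2 + y'\<^sup>2 + z'\<^sup>2) = u\<^sup>2 + v\<^sup>2 + w\<^sup>2"
      using less.hyps by meson
    moreover have "x\<^sup>2 + y\<^sup>2 + z\<^sup>2 = 9 * (x'\<^sup>2 + y'\<^sup>2 + z'\<^sup>2)"
      using eq by (simp add: power_mult_distrib)
    ultimately show ?thesis using nine_mult_three_squares_step[of u v w] by simp
  qed
qed

corollary three_squares_not_dvd_3:
  fixes x y z :: int
  assumes "3 dvd x" "3 dvd y" "3 dvd z" "x \<noteq> 0 \<or> y \<noteq> 0 \<or> z \<noteq> 0"
  shows "\<exists>u v w. \<not> 3 dvd u \<and> \<not> 3 dvd v \<and> \<not> 3 dvd w \<and> x\<^sup>2 + y\<^sup>2 + z\<^sup>2 = u\<^sup>2 + v\<^sup>2 + w\<^sup>2"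
proof -
  obtain x' y' z' where eq: "x = 3 * x'" "y = 3 * y'" "z = 3 * z'"
    using assms by (auto elim!: dvdE)
  then have "x\<^sup>2 + y\<^sup>2 + z\<^sup>2 = 9 * (x'\<^sup>2 + y'\<^sup>2 + z'\<^sup>2)" by (simp add: power_mult_distrib)
  then show ?thesis using nine_mult_three_squares[of x' y' z'] assms(4) eq by auto
qed

section \<open>Ordering the entries and finding two coprime to 3\<close>

text \<open>Adjacent transpositions generate all permutations, so the entries satisfying
  \<open>Q\<close> can be moved to the front. Below, \<open>Q\<close> is being nonzero, coprime to
  3, odd, or divisible by 3.\<close>

lemma sort_four:
  assumes "P a b c d"
    and "\<And>a b c d. P a b c d \<Longrightarrow> P b a c d"
    and "\<And>a b c d. P a b c d \<Longrightarrow> P a c b d"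
    and "\<And>a b c d. P a b c d \<Longrightarrow> P a b d c"
  shows "\<exists>a b c d. P a b c d \<and> (Q b \<longrightarrow> Q a) \<and> (Q c \<longrightarrow> Q b) \<and> (Q d \<longrightarrow> Q c)"
proof -
  have max: "\<exists>a b c d. P a b c d \<and> (Q b \<or> Q c \<or> Q d \<longrightarrow> Q a)"
    using assms by metis
  have "\<exists>a b c d. P a b c d \<and> (Q b \<or> Q c \<or> Q d \<longrightarrow> Q a) \<and> (Q c \<or> Q d \<longrightarrow> Q b)"
    using max assms(3,4) by metis
  then show ?thesis using assms(4) by metis
qed

lemma four_squares_nontrivial:
  fixes n :: int
  assumes "2 \<le> n"
  shows "\<exists>x y z w. n = x\<^sup>2 + y\<^sup>2 + z\<^sup>2 + w\<^sup>2 \<and> x \<noteq> 0 \<and> y \<noteq> 0"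
  using assms
proof (induction "nat n" arbitrary: n rule: less_induct)
  case less
  let ?P = "\<lambda>x y z w. n = x\<^sup>2 + y\<^sup>2 + z\<^sup>2 + w\<^sup>2"
  obtain x y z w where "?P x y z w"
    using lagrange_four_squares[of n] less.prems unfolding sum_four_squares_def by auto
  then have "\<exists>x y z w. ?P x y z w \<and> (y \<noteq> 0 \<longrightarrow> x \<noteq> 0) \<and> (z \<noteq> 0 \<longrightarrow> y \<noteq> 0) \<and> (w \<noteq> 0 \<longrightarrow> z \<noteq> 0)"
    by (intro sort_four[of ?P]) simp_all
  then obtain x y z w where n: "n = x\<^sup>2 + y\<^sup>2 + z\<^sup>2 + w\<^sup>2"
    and nz: "y \<noteq> 0 \<longrightarrow> x \<noteq> 0" "z \<noteq> 0 \<longrightarrow> y \<noteq> 0" "w \<noteq> 0 \<longrightarrow> z \<noteq> 0" by blast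
  show ?case
  proof (cases "y = 0")
    case True
    define a where "a = \<bar>x\<bar>"
    have n: "n = a\<^sup>2" using True n nz by (simp add: a_def)
    have "a \<noteq> 0" "a \<noteq> 1" using n less.prems by auto
    then have a: "2 \<le> a" by (simp add: a_def)
    then have "a * 2 \<le> a * a" by (intro mult_left_mono) auto
    then have "a < n" using n a by (simp add: power2_eq_square)
    show ?thesis
    \<comment> \<open>Even \<open>a\<close> is treated apart because the real part of the squared
      quaternion could vanish, as for \<open>a = 1\<^sup>2 + 1\<^sup>2\<close>.\<close>
    proof (cases "even a")
      case True
      then obtain b where "a = 2 * b" by blast
      then have "n = b\<^sup>2 + b\<^sup>2 + b\<^sup>2 + b\<^sup>2 \<and> b \<noteq> 0" using a n by (simp add: power2_eq_square)
      then show ?thesis by blast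
    next
      case False
      obtain x y z w where a': "a = x\<^sup>2 + y\<^sup>2 + z\<^sup>2 + w\<^sup>2" and nz: "x \<noteq> 0" "y \<noteq> 0"
        using less.hyps[of a] a \<open>a < n\<close> by auto
      \<comment> \<open>The parts of the square of the quaternion
        \<open>x + y i + z j + w k\<close>. The real part has the parity of \<open>a\<close>, hence
        is nonzero; \<open>2 * x * y\<close> is the second nonzero entry.\<close>
      have "n = (x\<^sup>2 - y\<^sup>2 - z\<^sup>2 - w\<^sup>2)\<^sup>2 + (2 * x * y)\<^sup>2 + (2 * x * z)\<^sup>2 + (2 * x * w)\<^sup>2"
        unfolding n a' by (simp add: power2_eq_square algebra_simps)
      moreover have "odd (x\<^sup>2 - y\<^sup>2 - z\<^sup>2 - w\<^sup>2)" using False a' by simp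
      then have "x\<^sup>2 - y\<^sup>2 - z\<^sup>2 - w\<^sup>2 \<noteq> 0" by (metis even_zero)
      moreover have "2 * x * y \<noteq> 0" using nz by simp
      ultimately show ?thesis by blast
    qed
  qed (use n nz in blast)
qed

text \<open>After sorting, \<open>3 dvd y\<close> implies that \<open>z\<close> and \<open>w\<close>
  are divisible by 3 too; these three are not all zero, so they can be replaced. The bound 2
  matters: 1 is only represented with three zeros.\<close>

lemma four_squares_not_dvd_3:
  fixes n :: int
  assumes "2 \<le> n"
  shows "\<exists>x y z w. n = x\<^sup>2 + y\<^sup>2 + z\<^sup>2 + w\<^sup>2 \<and> \<not> 3 dvd x \<and> \<not> 3 dvd y"
proof -
  \<comment> \<open>At least two entries are nonzero, phrased symmetrically so that sorting
    preserves it.\<close>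
  let ?P = "\<lambda>x y z w. n = x\<^sup>2 + y\<^sup>2 + z\<^sup>2 + w\<^sup>2 \<and>
    (y \<noteq> 0 \<or> z \<noteq> 0 \<or> w \<noteq> 0) \<and> (x \<noteq> 0 \<or> z \<noteq> 0 \<or> w \<noteq> 0) \<and>
    (x \<noteq> 0 \<or> y \<noteq> 0 \<or> w \<noteq> 0) \<and> (x \<noteq> 0 \<or> y \<noteq> 0 \<or> z \<noteq> 0)"
  obtain x y z w where "?P x y z w" using four_squares_nontrivial[OF assms] by blast
  then have "\<exists>x y z w. ?P x y z w \<and> (\<not> 3 dvd y \<longrightarrow> \<not> 3 dvd x) \<and> (\<not> 3 dvd z \<longrightarrow> \<not> 3 dvd y) \<and> (\<not> 3 dvd w \<longrightarrow> \<not> 3 dvd z)"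
    by (rule sort_four[of ?P]) auto
  then obtain x y z w where n: "n = x\<^sup>2 + y\<^sup>2 + z\<^sup>2 + w\<^sup>2" and nz: "y \<noteq> 0 \<or> z \<noteq> 0 \<or> w \<noteq> 0"
    and dvd: "3 dvd x \<longrightarrow> 3 dvd y" "3 dvd y \<longrightarrow> 3 dvd z" "3 dvd z \<longrightarrow> 3 dvd w" by blast
  show ?thesis
  proof (cases "3 dvd y")
    case True
    then obtain s t u where stu: "\<not> 3 dvd s" "\<not> 3 dvd t" "y\<^sup>2 + z\<^sup>2 + w\<^sup>2 = s\<^sup>2 + t\<^sup>2 + u\<^sup>2"
      using three_squares_not_dvd_3[of y z w] dvd nz by blast
    then have "n = s\<^sup>2 + t\<^sup>2 + u\<^sup>2 + x\<^sup>2" using n by simp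
    then show ?thesis using stu by blast
  qed (use n dvd in blast)
qed

section \<open>Counting odd entries and entries coprime to 3\<close>

lemma square_mod_4:
  fixes x :: int
  shows "x\<^sup>2 mod 4 = of_bool (odd x)"
proof -
  have "x mod 4 = 0 \<or> x mod 4 = 1 \<or> x mod 4 = 2 \<or> x mod 4 = 3" by presburger
  moreover have "odd x \<longleftrightarrow> x mod 4 = 1 \<or> x mod 4 = 3" by presburger
  ultimately show ?thesis by (auto simp: power2_eq_square mod_mult_eq[symmetric, of x x])
qed

lemma odd_square_mod_8:
  fixes x :: int
  assumes "odd x"
  shows "x\<^sup>2 mod 8 = 1"
proof -
  have "x mod 8 = 1 \<or> x mod 8 = 3 \<or> x mod 8 = 5 \<or> x mod 8 = 7" using assms by presburger
  then show ?thesis by (auto simp: power2_eq_square mod_mult_eq[symmetric, of x x])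
qed

lemma even_square_mod_8:
  fixes x :: int
  assumes "even x"
  shows "x\<^sup>2 mod 8 = (if 4 dvd x then 0 else 4)"
proof -
  have "x mod 8 = 0 \<or> x mod 8 = 2 \<or> x mod 8 = 4 \<or> x mod 8 = 6" using assms by presburger
  moreover have "4 dvd x \<longleftrightarrow> x mod 8 = 0 \<or> x mod 8 = 4" by presburger
  ultimately show ?thesis by (auto simp: power2_eq_square mod_mult_eq[symmetric, of x x])
qed

text \<open>At most two of the four entries are divisible by 3.\<close>
definition four_squares_rep :: "int \<Rightarrow> int \<Rightarrow> int \<Rightarrow> int \<Rightarrow> int \<Rightarrow> bool" where
  "four_squares_rep n a b c d \<longleftrightarrow> n = a\<^sup>2 + b\<^sup>2 + c\<^sup>2 + d\<^sup>2 \<and>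
     \<not> (3 dvd a \<and> 3 dvd b \<and> 3 dvd c) \<and> \<not> (3 dvd a \<and> 3 dvd b \<and> 3 dvd d) \<and>
     \<not> (3 dvd a \<and> 3 dvd c \<and> 3 dvd d) \<and> \<not> (3 dvd b \<and> 3 dvd c \<and> 3 dvd d)"

lemma four_squares_rep_sum: "four_squares_rep n a b c d \<Longrightarrow> n = a\<^sup>2 + b\<^sup>2 + c\<^sup>2 + d\<^sup>2"
  by (simp add: four_squares_rep_def)

lemma ex_four_squares_rep:
  assumes "2 \<le> n"
  shows "\<exists>a b c d. four_squares_rep n a b c d \<and>
    (odd b \<longrightarrow> odd a) \<and> (odd c \<longrightarrow> odd b) \<and> (odd d \<longrightarrow> odd c)"
proof -
  obtain a b c d where "four_squares_rep n a b c d"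
    using four_squares_not_dvd_3[OF assms] unfolding four_squares_rep_def by blast
  then show ?thesis
    by (rule sort_four) (auto simp: four_squares_rep_def)
qed

lemma four_squares_rep_parity:
  assumes "four_squares_rep n a b c d"
  shows "n mod 4 = (of_bool (odd a) + of_bool (odd b) + of_bool (odd c) + of_bool (odd d)) mod 4"
proof -
  have "\<exists>k. x\<^sup>2 = 4 * k + of_bool (odd x)" for x :: int
    using square_mod_4[of x] by (metis mult_div_mod_eq)
  then obtain k l m j where "a\<^sup>2 = 4 * k + of_bool (odd a)" "b\<^sup>2 = 4 * l + of_bool (odd b)"
      "c\<^sup>2 = 4 * m + of_bool (odd c)" "d\<^sup>2 = 4 * j + of_bool (odd d)" by metis
  then have "n = (of_bool (odd a) + of_bool (odd b) + of_bool (odd c) + of_bool (odd d)) +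
      4 * (k + l + m + j)"
    using four_squares_rep_sum[OF assms] by simp
  then show ?thesis by (metis mod_mult_self2)
qed

lemma four_squares_rep_dvd_3:
  assumes "four_squares_rep n a b c d"
  shows "n mod 3 = (of_bool (\<not> 3 dvd a) + of_bool (\<not> 3 dvd b) + of_bool (\<not> 3 dvd c) +
    of_bool (\<not> 3 dvd d)) mod 3"
proof -
  have "\<exists>k. x\<^sup>2 = 3 * k + of_bool (\<not> 3 dvd x)" for x :: int
    using square_mod_3[of x] by (metis mult_div_mod_eq of_bool_eq)
  then obtain k l m j where "a\<^sup>2 = 3 * k + of_bool (\<not> 3 dvd a)" "b\<^sup>2 = 3 * l + of_bool (\<not> 3 dvd b)"
      "c\<^sup>2 = 3 * m + of_bool (\<not> 3 dvd c)" "d\<^sup>2 = 3 * j + of_bool (\<not> 3 dvd d)" by metis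
  then have "n = (of_bool (\<not> 3 dvd a) + of_bool (\<not> 3 dvd b) + of_bool (\<not> 3 dvd c) +
      of_bool (\<not> 3 dvd d)) + 3 * (k + l + m + j)"
    using four_squares_rep_sum[OF assms] by simp
  then show ?thesis by (metis mod_mult_self2)
qed

text \<open>At least two entries are coprime to 3, and their number is 1 modulo 3, so it is
  4.\<close>

lemma four_squares_rep_mod_3_1:
  assumes "four_squares_rep n a b c d" "n mod 3 = 1"
  shows "\<not> 3 dvd a \<and> \<not> 3 dvd b \<and> \<not> 3 dvd c \<and> \<not> 3 dvd d"
proof -
  have "\<not> (3 dvd a \<and> 3 dvd b \<and> 3 dvd c)" "\<not> (3 dvd a \<and> 3 dvd b \<and> 3 dvd d)"
    "\<not> (3 dvd a \<and> 3 dvd c \<and> 3 dvd d)" "\<not> (3 dvd b \<and> 3 dvd c \<and> 3 dvd d)"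
    using assms(1) unfolding four_squares_rep_def by blast+
  then show ?thesis
    using four_squares_rep_dvd_3[OF assms(1)] unfolding assms(2)
    by (cases "3 dvd a"; cases "3 dvd b"; cases "3 dvd c"; cases "3 dvd d") simp_all
qed

text \<open>The number of odd entries is at most 4 and congruent to \<open>n\<close> modulo 4, so a
  nonzero residue determines it, and sorting locates them. The next two lemmas argue alike.\<close>

lemma ex_four_squares_rep_one_odd:
  assumes "2 \<le> n" "n mod 4 = 1"
  shows "\<exists>a b c d. four_squares_rep n a b c d \<and> odd a \<and> even b \<and> even c \<and> even d"
proof -
  obtain a b c d where "four_squares_rep n a b c d" "odd b \<longrightarrow> odd a" "odd c \<longrightarrow> odd b" "odd d \<longrightarrow> odd c"
    using ex_four_squares_rep[OF assms(1)] by blast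
  then show ?thesis using four_squares_rep_parity[of n a b c d] assms(2)
    by (cases "odd a"; cases "odd b"; cases "odd c"; cases "odd d") auto
qed

lemma ex_four_squares_rep_two_odd:
  assumes "2 \<le> n" "n mod 4 = 2"
  shows "\<exists>a b c d. four_squares_rep n a b c d \<and> odd a \<and> odd b \<and> even c \<and> even d"
proof -
  obtain a b c d where "four_squares_rep n a b c d" "odd b \<longrightarrow> odd a" "odd c \<longrightarrow> odd b" "odd d \<longrightarrow> odd c"
    using ex_four_squares_rep[OF assms(1)] by blast
  then show ?thesis using four_squares_rep_parity[of n a b c d] assms(2)
    by (cases "odd a"; cases "odd b"; cases "odd c"; cases "odd d") auto
qed

lemma ex_four_squares_rep_three_odd:
  assumes "2 \<le> n" "n mod 4 = 3"
  shows "\<exists>a b c d. four_squares_rep n a b c d \<and> odd a \<and> odd b \<and> odd c \<and> even d"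
proof -
  obtain a b c d where "four_squares_rep n a b c d" "odd b \<longrightarrow> odd a" "odd c \<longrightarrow> odd b" "odd d \<longrightarrow> odd c"
    using ex_four_squares_rep[OF assms(1)] by blast
  then show ?thesis using four_squares_rep_parity[of n a b c d] assms(2)
    by (cases "odd a"; cases "odd b"; cases "odd c"; cases "odd d") auto
qed

text \<open>Residues modulo 8 distinguish an even entry that is twice an odd number from a multiple
  of 4; this decides which polygonal number the entry can yield.\<close>

lemma three_odd_squares_mod_8:
  fixes a b c d :: int
  assumes "odd a" "odd b" "odd c" "even d"
  shows "(a\<^sup>2 + b\<^sup>2 + c\<^sup>2 + d\<^sup>2) mod 8 = (if 4 dvd d then 3 else 7)"
proof -
  have "(a\<^sup>2 + b\<^sup>2 + c\<^sup>2 + d\<^sup>2) mod 8 = (1 + 1 + 1 + d\<^sup>2 mod 8) mod 8"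
    using assms by (intro mod_add_cong) (simp_all add: odd_square_mod_8)
  then show ?thesis using even_square_mod_8[OF assms(4)] by simp
qed

subsection \<open>Polygonal numbers\<close>

text \<open>Integers satisfy \<open>\<bar>x\<bar> \<le> x\<^sup>2\<close>, and
  \<open>\<bar>m - 4\<bar> \<le> m - 2\<close> holds from \<open>m = 3\<close> on.\<close>

lemma polyg_nonneg:
  assumes "3 \<le> m"
  shows "0 \<le> polyg m x"
proof -
  have "\<bar>x\<bar> * 1 \<le> \<bar>x\<bar> * \<bar>x\<bar>" by (cases "x = 0") (simp, intro mult_left_mono, auto)
  then have "\<bar>x\<bar> \<le> x\<^sup>2" by (simp add: power2_eq_square)
  have "(m - 4) * x \<le> \<bar>m - 4\<bar> * \<bar>x\<bar>" by (metis abs_ge_self abs_mult)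
  also have "\<dots> \<le> (m - 2) * x\<^sup>2"
    using assms \<open>\<bar>x\<bar> \<le> x\<^sup>2\<close> by (intro mult_mono) auto
  finally show ?thesis by (simp add: polyg_def)
qed

lemma universal4I:
  assumes "0 \<le> a" "0 \<le> b" "0 \<le> c" "0 \<le> d" "3 \<le> r" "3 \<le> s" "3 \<le> t" "3 \<le> u"
    and "\<And>k. 0 \<le> k \<Longrightarrow> \<exists>h l m n. k = a * polyg r h + b * polyg s l + c * polyg t m + d * polyg u n"
  shows "universal4 a r b s c t d u"
  using assms(9) polyg_nonneg assms(1-8) unfolding universal4_def
  by (auto intro!: add_nonneg_nonneg mult_nonneg_nonneg)

lemma polyg_4: "polyg 4 x = x\<^sup>2"
  by (simp add: polyg_def)

text \<open>This and the next two lemmas invert the completed squares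
  \<open>(2 * x + 1)\<^sup>2\<close>, \<open>(6 * x - 1)\<^sup>2\<close> and
  \<open>(3 * x - 1)\<^sup>2\<close>; for the last two the sign of \<open>a\<close> is adjusted
  first.\<close>

lemma ex_polyg_3:
  assumes "odd a"
  shows "\<exists>x. a\<^sup>2 = 8 * polyg 3 x + 1"
proof -
  obtain x where a: "a = 2 * x + 1" using assms by (elim oddE)
  have "even (x\<^sup>2 + x)" by simp
  then have "2 * polyg 3 x = x\<^sup>2 + x" by (simp add: polyg_def)
  then have "a\<^sup>2 = 8 * polyg 3 x + 1" by (simp add: a power2_eq_square algebra_simps)
  then show ?thesis ..
qed

lemma ex_polyg_5:
  assumes "odd a" "\<not> 3 dvd a"
  shows "\<exists>x. a\<^sup>2 = 24 * polyg 5 x + 1"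
proof -
  have "(\<exists>x. a = 6 * x - 1) \<or> (\<exists>x. - a = 6 * x - 1)" using assms by presburger
  then obtain x where "a = 6 * x - 1 \<or> - a = 6 * x - 1" by blast
  then have a: "a\<^sup>2 = (6 * x - 1)\<^sup>2" by (metis power2_minus)
  have "even (3 * x\<^sup>2 - x)" by simp
  then have "2 * polyg 5 x = 3 * x\<^sup>2 - x" by (simp add: polyg_def)
  then have "a\<^sup>2 = 24 * polyg 5 x + 1" unfolding a by (simp add: power2_eq_square algebra_simps)
  then show ?thesis ..
qed

lemma ex_polyg_8:
  assumes "\<not> 3 dvd a"
  shows "\<exists>x. a\<^sup>2 = 3 * polyg 8 x + 1"
proof -
  have "(\<exists>x. a = 3 * x - 1) \<or> (\<exists>x. - a = 3 * x - 1)" using assms by presburger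
  then obtain x where "a = 3 * x - 1 \<or> - a = 3 * x - 1" by blast
  then have a: "a\<^sup>2 = (3 * x - 1)\<^sup>2" by (metis power2_minus)
  have "6 * x\<^sup>2 - 4 * x = 2 * (3 * x\<^sup>2 - 2 * x)" by simp
  then have "polyg 8 x = 3 * x\<^sup>2 - 2 * x" unfolding polyg_def by simp
  then have "a\<^sup>2 = 3 * polyg 8 x + 1" unfolding a by (simp add: power2_eq_square algebra_simps)
  then show ?thesis ..
qed

section \<open>Sums read off directly from residues modulo 3 and 4\<close>

text \<open>Multiplying by 12 and completing squares adds \<open>1 + 1 + 4 + 4 = 10\<close>. Residue
  2 modulo 4 gives two odd entries, residue 1 modulo 3 makes all entries coprime to 3.\<close>

lemma universal_2p5_2p5_p8_p8: "universal4 2 5 2 5 1 8 1 8"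
proof (rule universal4I)
  fix n :: int assume "0 \<le> n"
  then have "2 \<le> 12 * n + 10" "(12 * n + 10) mod 4 = 2" "(12 * n + 10) mod 3 = 1" by presburger+
  then obtain a b c d where rep: "four_squares_rep (12 * n + 10) a b (2 * c) (2 * d)" "odd a" "odd b"
    by (metis ex_four_squares_rep_two_odd evenE)
  then have "\<not> 3 dvd a" "\<not> 3 dvd b" "\<not> 3 dvd c" "\<not> 3 dvd d"
    using four_squares_rep_mod_3_1 \<open>(12 * n + 10) mod 3 = 1\<close> by (meson dvd_mult)+
  then obtain h l m k where "a\<^sup>2 = 24 * polyg 5 h + 1" "b\<^sup>2 = 24 * polyg 5 l + 1"
      "c\<^sup>2 = 3 * polyg 8 m + 1" "d\<^sup>2 = 3 * polyg 8 k + 1"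
    using ex_polyg_5 ex_polyg_8 rep(2,3) by meson
  then have "n = 2 * polyg 5 h + 2 * polyg 5 l + 1 * polyg 8 m + 1 * polyg 8 k"
    using four_squares_rep_sum[OF rep(1)] by (simp add: power_mult_distrib)
  then show "\<exists>h l m k. n = 2 * polyg 5 h + 2 * polyg 5 l + 1 * polyg 8 m + 1 * polyg 8 k" by blast
qed simp_all

lemma universal_p8_p8_p8_p8: "universal4 1 8 1 8 1 8 1 8"
proof (rule universal4I)
  fix n :: int assume "0 \<le> n"
  then have "2 \<le> 3 * n + 4" "(3 * n + 4) mod 3 = 1" by presburger+
  then obtain a b c d where rep: "four_squares_rep (3 * n + 4) a b c d"
    by (metis ex_four_squares_rep)
  then have "\<not> 3 dvd a" "\<not> 3 dvd b" "\<not> 3 dvd c" "\<not> 3 dvd d"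
    using four_squares_rep_mod_3_1 \<open>(3 * n + 4) mod 3 = 1\<close> by meson+
  then obtain h l m k where "a\<^sup>2 = 3 * polyg 8 h + 1" "b\<^sup>2 = 3 * polyg 8 l + 1"
      "c\<^sup>2 = 3 * polyg 8 m + 1" "d\<^sup>2 = 3 * polyg 8 k + 1"
    using ex_polyg_8 by meson
  then have "n = 1 * polyg 8 h + 1 * polyg 8 l + 1 * polyg 8 m + 1 * polyg 8 k"
    using four_squares_rep_sum[OF rep] by simp
  then show "\<exists>h l m k. n = 1 * polyg 8 h + 1 * polyg 8 l + 1 * polyg 8 m + 1 * polyg 8 k" by blast
qed simp_all

text \<open>Residue 2 modulo 3 leaves exactly two entries divisible by 3; they give the two terms
  \<open>3 * polyg 4\<close>.\<close>

lemma universal_3p4_3p4_p8_p8: "universal4 3 4 3 4 1 8 1 8"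
proof (rule universal4I)
  fix n :: int assume "0 \<le> n"
  let ?P = "four_squares_rep (3 * n + 2)"
  obtain a b c d where "?P a b c d"
    using ex_four_squares_rep[of "3 * n + 2"] \<open>0 \<le> n\<close> by auto
  then have "\<exists>a b c d. ?P a b c d \<and> (3 dvd b \<longrightarrow> 3 dvd a) \<and> (3 dvd c \<longrightarrow> 3 dvd b) \<and> (3 dvd d \<longrightarrow> 3 dvd c)"
    by (rule sort_four) (auto simp: four_squares_rep_def)
  then obtain a b c d where rep: "?P a b c d"
    and "3 dvd b \<longrightarrow> 3 dvd a" "3 dvd c \<longrightarrow> 3 dvd b" "3 dvd d \<longrightarrow> 3 dvd c" by blast
  moreover have "(3 * n + 2) mod 3 = 2" by presburger
  ultimately have dvd: "3 dvd a" "3 dvd b" "\<not> 3 dvd c" "\<not> 3 dvd d"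
    using four_squares_rep_dvd_3[OF rep]
    by (cases "3 dvd a"; cases "3 dvd b"; cases "3 dvd c"; cases "3 dvd d"; simp)+
  then obtain h l where "a = 3 * h" "b = 3 * l" by (elim dvdE)
  moreover obtain m k where "c\<^sup>2 = 3 * polyg 8 m + 1" "d\<^sup>2 = 3 * polyg 8 k + 1"
    using ex_polyg_8 dvd by meson
  ultimately have "n = 3 * polyg 4 h + 3 * polyg 4 l + 1 * polyg 8 m + 1 * polyg 8 k"
    using four_squares_rep_sum[OF rep] by (simp add: power_mult_distrib polyg_4)
  then show "\<exists>h l m k. n = 3 * polyg 4 h + 3 * polyg 4 l + 1 * polyg 8 m + 1 * polyg 8 k" by blast
qed simp_all

section \<open>Sums derived from doubling a number congruent to 1 modulo 6\<close>

text \<open>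
  Write \<open>6 n + 7 = a\<^sup>2 + d\<^sup>2 + b\<^sup>2 + c\<^sup>2\<close> with all entries coprime to 3, \<open>a\<close> and \<open>d\<close> of opposite
  parity, \<open>b\<close> and \<open>c\<close> of equal parity, and double it with \<open>2 (a\<^sup>2 + d\<^sup>2) = (a - d)\<^sup>2 + (a + d)\<^sup>2\<close>.
\<close>
lemma four_squares_mod_12_2:
  fixes n :: int
  assumes "0 \<le> n"
  shows "\<exists>x y z w. 12 * n + 14 = (3 * x)\<^sup>2 + y\<^sup>2 + (6 * z)\<^sup>2 + (2 * w)\<^sup>2 \<and>
    odd x \<and> odd y \<and> \<not> 3 dvd y \<and> \<not> 3 dvd w"
proof -
  have N: "2 \<le> 6 * n + 7" "(6 * n + 7) mod 3 = 1" "odd (6 * n + 7)" using assms by presburger+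
  then obtain a b c d where rep: "four_squares_rep (6 * n + 7) a b c d"
    and par: "odd b \<longrightarrow> odd a" "odd c \<longrightarrow> odd b" "odd d \<longrightarrow> odd c"
    using ex_four_squares_rep by blast
  have sum: "6 * n + 7 = a\<^sup>2 + b\<^sup>2 + c\<^sup>2 + d\<^sup>2" by (rule four_squares_rep_sum[OF rep])
  have "odd (a\<^sup>2 + b\<^sup>2 + c\<^sup>2 + d\<^sup>2)" using N(3) unfolding sum .
  then have "odd (a + b + c + d)" by simp
  then have par: "odd a" "even d" "even (b - c)" using par by auto
  have dvd: "\<not> 3 dvd a" "\<not> 3 dvd b" "\<not> 3 dvd c" "\<not> 3 dvd d"
    using four_squares_rep_mod_3_1[OF rep N(2)] by blast+
  \<comment> \<open>The signs of \<open>d\<close> and \<open>c\<close> make the differences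
    divisible by 3; the sums are then \<open>2 * a\<close> and \<open>2 * b\<close> modulo 3, hence
    coprime to 3.\<close>
  have "3 dvd a - d \<or> 3 dvd a - (- d)" using dvd by presburger
  then obtain d' where d': "d'\<^sup>2 = d\<^sup>2" "even d'" "3 dvd a - d'"
    using par by (metis power2_minus even_minus)
  have "3 dvd b - c \<or> 3 dvd b - (- c)" using dvd by presburger
  then obtain c' where c': "c'\<^sup>2 = c\<^sup>2" "even (b - c')" "3 dvd b - c'"
    using par by (metis power2_minus even_minus even_diff_iff even_add)
  obtain x where x: "a - d' = 3 * x" using d' by (elim dvdE)
  have "6 dvd b - c'" using c' by presburger
  then obtain z where z: "b - c' = 6 * z" by (elim dvdE)
  have "2 dvd b + c'" using c' by presburger
  then obtain w where w: "b + c' = 2 * w" by (elim dvdE)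
  have "odd x" "odd (a + d')" "\<not> 3 dvd a + d'" "\<not> 3 dvd w"
    using x z w par d' dvd by presburger+
  moreover have "12 * n + 14 = (3 * x)\<^sup>2 + (a + d')\<^sup>2 + (6 * z)\<^sup>2 + (2 * w)\<^sup>2"
    unfolding x[symmetric] z[symmetric] w[symmetric]
    using sum c'(1) d'(1) by (simp add: power2_eq_square algebra_simps)
  ultimately show ?thesis by blast
qed

text \<open>The constant is \<open>14 = 9 + 1 + 4\<close>, from \<open>(3 * x)\<^sup>2\<close>,
  \<open>y\<^sup>2\<close> and \<open>(2 * w)\<^sup>2\<close>.\<close>

lemma universal_6p3_3p4_2p5_p8: "universal4 6 3 3 4 2 5 1 8"
proof (rule universal4I)
  fix n :: int assume "0 \<le> n"
  then obtain x y z w where eq: "12 * n + 14 = (3 * x)\<^sup>2 + y\<^sup>2 + (6 * z)\<^sup>2 + (2 * w)\<^sup>2"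
    and "odd x" "odd y" "\<not> 3 dvd y" "\<not> 3 dvd w" using four_squares_mod_12_2 by blast
  then obtain h m k where "x\<^sup>2 = 8 * polyg 3 h + 1" "y\<^sup>2 = 24 * polyg 5 m + 1" "w\<^sup>2 = 3 * polyg 8 k + 1"
    using ex_polyg_3 ex_polyg_5 ex_polyg_8 by meson
  then have "n = 6 * polyg 3 h + 3 * polyg 4 z + 2 * polyg 5 m + 1 * polyg 8 k"
    using eq by (simp add: power_mult_distrib polyg_4)
  then show "\<exists>h l m k. n = 6 * polyg 3 h + 3 * polyg 4 l + 2 * polyg 5 m + 1 * polyg 8 k" by blast
qed simp_all

text \<open>The parity of \<open>z + w\<close> is that of \<open>3 * z + w\<close> and
  \<open>3 * z - w\<close>, the entries used in the next two sums.\<close>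

lemma odd_two_squares_mod_8:
  fixes x y z w :: int
  assumes "odd x" "odd y"
  shows "((3 * x)\<^sup>2 + y\<^sup>2 + (6 * z)\<^sup>2 + (2 * w)\<^sup>2) mod 8 = (if even (z + w) then 2 else 6)"
proof -
  have "odd (3 * x)" using assms by simp
  then have "((3 * x)\<^sup>2 + y\<^sup>2 + (6 * z)\<^sup>2 + (2 * w)\<^sup>2) mod 8 =
      (1 + 1 + (6 * z)\<^sup>2 mod 8 + (2 * w)\<^sup>2 mod 8) mod 8"
    using odd_square_mod_8[of "3 * x"] odd_square_mod_8[OF assms(2)]
    by (intro mod_add_cong) simp_all
  moreover have "4 dvd 6 * z \<longleftrightarrow> even z" "4 dvd 2 * w \<longleftrightarrow> even w" by presburger+
  ultimately show ?thesis using even_square_mod_8[of "6 * z"] even_square_mod_8[of "2 * w"] by simp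
qed

text \<open>Scaling by 24 needs \<open>24 * n + 14\<close>, hence the argument \<open>2 * n\<close>.
  Residue 6 modulo 8 makes \<open>3 * z + w\<close> and \<open>3 * z - w\<close> odd, as pentagonal
  numbers require.\<close>

lemma universal_3p3_p5_2p5_2p5: "universal4 3 3 1 5 2 5 2 5"
proof (rule universal4I)
  fix n :: int assume "0 \<le> n"
  then have "0 \<le> 2 * n" by simp
  then obtain x y z w where eq: "12 * (2 * n) + 14 = (3 * x)\<^sup>2 + y\<^sup>2 + (6 * z)\<^sup>2 + (2 * w)\<^sup>2"
    and *: "odd x" "odd y" "\<not> 3 dvd y" "\<not> 3 dvd w" using four_squares_mod_12_2 by blast
  have "(12 * (2 * n) + 14) mod 8 = 6" by presburger
  then have "odd (z + w)" using odd_two_squares_mod_8[OF *(1,2), of z w] unfolding eq by presburger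
  then have "odd (3 * z + w)" "odd (3 * z - w)" "\<not> 3 dvd 3 * z + w" "\<not> 3 dvd 3 * z - w"
    using * by presburger+
  then obtain h l m k where "x\<^sup>2 = 8 * polyg 3 h + 1" "y\<^sup>2 = 24 * polyg 5 l + 1"
      "(3 * z + w)\<^sup>2 = 24 * polyg 5 m + 1" "(3 * z - w)\<^sup>2 = 24 * polyg 5 k + 1"
    using ex_polyg_3 ex_polyg_5 * by meson
  moreover have "(6 * z)\<^sup>2 + (2 * w)\<^sup>2 = 2 * (3 * z + w)\<^sup>2 + 2 * (3 * z - w)\<^sup>2"
    by (simp add: power2_eq_square algebra_simps)
  ultimately have "n = 3 * polyg 3 h + 1 * polyg 5 l + 2 * polyg 5 m + 2 * polyg 5 k"
    using eq power_mult_distrib[of 3 x 2] by simp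
  then show "\<exists>h l m k. n = 3 * polyg 3 h + 1 * polyg 5 l + 2 * polyg 5 m + 2 * polyg 5 k" by blast
qed simp_all

text \<open>Here the constant is \<open>9 + 1 + 8 + 8 = 26\<close>, hence the argument
  \<open>2 * n + 1\<close>. Residue 2 modulo 8 makes \<open>3 * z + w\<close> and
  \<open>3 * z - w\<close> even, and their halves give octagonal numbers.\<close>

lemma universal_3p3_p5_p8_p8: "universal4 3 3 1 5 1 8 1 8"
proof (rule universal4I)
  fix n :: int assume "0 \<le> n"
  then have "0 \<le> 2 * n + 1" by simp
  then obtain x y z w where eq: "12 * (2 * n + 1) + 14 = (3 * x)\<^sup>2 + y\<^sup>2 + (6 * z)\<^sup>2 + (2 * w)\<^sup>2"
    and *: "odd x" "odd y" "\<not> 3 dvd y" "\<not> 3 dvd w" using four_squares_mod_12_2 by blast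
  have "(12 * (2 * n + 1) + 14) mod 8 = 2" by presburger
  then have "even (z + w)" using odd_two_squares_mod_8[OF *(1,2), of z w] unfolding eq by presburger
  then have "even (3 * z + w)" "even (3 * z - w)" by presburger+
  then obtain b c where bc: "3 * z + w = 2 * b" "3 * z - w = 2 * c" by (elim evenE)
  then have "\<not> 3 dvd b" "\<not> 3 dvd c" using * by presburger+
  then obtain h l m k where "x\<^sup>2 = 8 * polyg 3 h + 1" "y\<^sup>2 = 24 * polyg 5 l + 1"
      "b\<^sup>2 = 3 * polyg 8 m + 1" "c\<^sup>2 = 3 * polyg 8 k + 1"
    using ex_polyg_3 ex_polyg_5 ex_polyg_8 * by meson
  moreover have "(6 * z)\<^sup>2 + (2 * w)\<^sup>2 = 2 * (3 * z + w)\<^sup>2 + 2 * (3 * z - w)\<^sup>2"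
    by (simp add: power2_eq_square algebra_simps)
  then have "(6 * z)\<^sup>2 + (2 * w)\<^sup>2 = 8 * b\<^sup>2 + 8 * c\<^sup>2" unfolding bc by (simp add: power_mult_distrib)
  ultimately have "n = 3 * polyg 3 h + 1 * polyg 5 l + 1 * polyg 8 m + 1 * polyg 8 k"
    using eq power_mult_distrib[of 3 x 2] by simp
  then show "\<exists>h l m k. n = 3 * polyg 3 h + 1 * polyg 5 l + 1 * polyg 8 m + 1 * polyg 8 k" by blast
qed simp_all

section \<open>Sums from residue 2 modulo 3, by pairing and doubling\<close>

text \<open>Exactly two entries are coprime to 3, so \<open>a\<close> has a partner \<open>s\<close>
  such that just one of them is divisible by 3. Then \<open>a + s\<close> and \<open>a - s\<close>
  are coprime to 3. The predicate \<open>P\<close> carries the parity along.\<close>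

lemma four_squares_rep_pair_3:
  assumes "four_squares_rep n a b c d" "n mod 3 = 2" "P b" "P c" "P d"
  shows "\<exists>s e f. n = a\<^sup>2 + s\<^sup>2 + e\<^sup>2 + f\<^sup>2 \<and> P s \<and> P e \<and> P f \<and> (3 dvd a \<longleftrightarrow> \<not> 3 dvd s) \<and> 3 dvd e \<and> \<not> 3 dvd f"
proof -
  have "n = a\<^sup>2 + b\<^sup>2 + c\<^sup>2 + d\<^sup>2" "n = a\<^sup>2 + b\<^sup>2 + d\<^sup>2 + c\<^sup>2" "n = a\<^sup>2 + c\<^sup>2 + b\<^sup>2 + d\<^sup>2"
    "n = a\<^sup>2 + c\<^sup>2 + d\<^sup>2 + b\<^sup>2" "n = a\<^sup>2 + d\<^sup>2 + b\<^sup>2 + c\<^sup>2" "n = a\<^sup>2 + d\<^sup>2 + c\<^sup>2 + b\<^sup>2"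
    using four_squares_rep_sum[OF assms(1)] by simp_all
  note sums = this
  show ?thesis
    using four_squares_rep_dvd_3[OF assms(1)] assms(2-)
    by (cases "3 dvd a"; cases "3 dvd b"; cases "3 dvd c"; cases "3 dvd d"; simp; use sums in blast)
qed

text \<open>Doubling \<open>12 * n + 5\<close> gives \<open>24 * n + 10\<close>, with
  \<open>10 = 1 + 1 + 8\<close> from \<open>a + s\<close>, \<open>a - s\<close> and
  \<open>f = 2 * g\<close>.\<close>

lemma universal_3p4_p5_p5_p8: "universal4 3 4 1 5 1 5 1 8"
proof (rule universal4I)
  fix n :: int assume "0 \<le> n"
  then have "2 \<le> 12 * n + 5" "(12 * n + 5) mod 4 = 1" "(12 * n + 5) mod 3 = 2" by presburger+
  then obtain a b c d where "four_squares_rep (12 * n + 5) a b c d" "odd a" "even b" "even c" "even d"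
    using ex_four_squares_rep_one_odd by blast
  then obtain s e f where eq: "12 * n + 5 = a\<^sup>2 + s\<^sup>2 + e\<^sup>2 + f\<^sup>2"
    and *: "odd a" "even s" "even e" "even f" "3 dvd a \<longleftrightarrow> \<not> 3 dvd s" "3 dvd e" "\<not> 3 dvd f"
    using four_squares_rep_pair_3[of "12 * n + 5" a b c d even] \<open>(12 * n + 5) mod 3 = 2\<close> by blast
  have "odd (a + s)" "odd (a - s)" "\<not> 3 dvd a + s" "\<not> 3 dvd a - s" using * by presburger+
  moreover have "6 dvd e" using * by presburger
  then obtain h where h: "e = 6 * h" by (elim dvdE)
  obtain g where g: "f = 2 * g" using * by (elim evenE)
  then have "\<not> 3 dvd g" using * by presburger
  ultimately obtain l m k where "(a + s)\<^sup>2 = 24 * polyg 5 l + 1" "(a - s)\<^sup>2 = 24 * polyg 5 m + 1"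
      "g\<^sup>2 = 3 * polyg 8 k + 1"
    using ex_polyg_5 ex_polyg_8 by meson
  moreover have "(a + s)\<^sup>2 + (a - s)\<^sup>2 = 2 * a\<^sup>2 + 2 * s\<^sup>2" by (simp add: power2_eq_square algebra_simps)
  ultimately have "n = 3 * polyg 4 h + 1 * polyg 5 l + 1 * polyg 5 m + 1 * polyg 8 k"
    using eq unfolding h g by (simp add: power_mult_distrib polyg_4)
  then show "\<exists>h l m k. n = 3 * polyg 4 h + 1 * polyg 5 l + 1 * polyg 5 m + 1 * polyg 8 k" by blast
qed simp_all

lemma universal_6p3_p5_p5_2p5: "universal4 6 3 1 5 1 5 2 5"
proof (rule universal4I)
  fix n :: int assume "0 \<le> n"
  then have "2 \<le> 12 * n + 11" "(12 * n + 11) mod 4 = 3" "(12 * n + 11) mod 3 = 2" by presburger+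
  then obtain b c d a where "four_squares_rep (12 * n + 11) b c d a" "odd b" "odd c" "odd d" "even a"
    using ex_four_squares_rep_three_odd by blast
  \<comment> \<open>The only even entry goes first, so that its partner is odd and
    \<open>a + s\<close>, \<open>a - s\<close> are odd.\<close>
  moreover from this have "four_squares_rep (12 * n + 11) a b c d"
    by (auto simp: four_squares_rep_def)
  ultimately obtain s e f where eq: "12 * n + 11 = a\<^sup>2 + s\<^sup>2 + e\<^sup>2 + f\<^sup>2"
    and *: "even a" "odd s" "odd e" "odd f" "3 dvd a \<longleftrightarrow> \<not> 3 dvd s" "3 dvd e" "\<not> 3 dvd f"
    using four_squares_rep_pair_3[of "12 * n + 11" a b c d odd] \<open>(12 * n + 11) mod 3 = 2\<close> by blast
  have "odd (a + s)" "odd (a - s)" "\<not> 3 dvd a + s" "\<not> 3 dvd a - s" using * by presburger+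
  moreover obtain g where g: "e = 3 * g" using * by (elim dvdE)
  then have "odd g" using * by simp
  ultimately obtain h l m k where "g\<^sup>2 = 8 * polyg 3 h + 1" "(a + s)\<^sup>2 = 24 * polyg 5 l + 1"
      "(a - s)\<^sup>2 = 24 * polyg 5 m + 1" "f\<^sup>2 = 24 * polyg 5 k + 1"
    using ex_polyg_3 ex_polyg_5 * by meson
  moreover have "(a + s)\<^sup>2 + (a - s)\<^sup>2 = 2 * a\<^sup>2 + 2 * s\<^sup>2" by (simp add: power2_eq_square algebra_simps)
  ultimately have "n = 6 * polyg 3 h + 1 * polyg 5 l + 1 * polyg 5 m + 2 * polyg 5 k"
    using eq unfolding g by (simp add: power_mult_distrib)
  then show "\<exists>h l m k. n = 6 * polyg 3 h + 1 * polyg 5 l + 1 * polyg 5 m + 2 * polyg 5 k" by blast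
qed simp_all

section \<open>Sums governed by the even entry modulo 4\<close>

text \<open>\<open>7 = 1 + 1 + 1 + 4\<close>; residue 7 modulo 8 makes the even entry twice an odd
  number.\<close>

lemma universal_p5_p5_p5_4p5: "universal4 1 5 1 5 1 5 4 5"
proof (rule universal4I)
  fix n :: int assume "0 \<le> n"
  then have N: "2 \<le> 24 * n + 7" "(24 * n + 7) mod 4 = 3" "(24 * n + 7) mod 3 = 1" "(24 * n + 7) mod 8 = 7"
    by presburger+
  then obtain a b c d where rep: "four_squares_rep (24 * n + 7) a b c d"
    and odd: "odd a" "odd b" "odd c" "even d"
    using ex_four_squares_rep_three_odd by blast
  have dvd: "\<not> 3 dvd a" "\<not> 3 dvd b" "\<not> 3 dvd c" "\<not> 3 dvd d"
    using four_squares_rep_mod_3_1[OF rep N(3)] by blast+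
  have "\<not> 4 dvd d"
    using three_odd_squares_mod_8[OF odd] N(4) four_squares_rep_sum[OF rep] by (auto split: if_splits)
  obtain g where g: "d = 2 * g" using odd by (elim evenE)
  then have "odd g" "\<not> 3 dvd g" using \<open>\<not> 4 dvd d\<close> dvd by presburger+
  then obtain h l m k where "a\<^sup>2 = 24 * polyg 5 h + 1" "b\<^sup>2 = 24 * polyg 5 l + 1"
      "c\<^sup>2 = 24 * polyg 5 m + 1" "g\<^sup>2 = 24 * polyg 5 k + 1"
    using ex_polyg_5 odd dvd by meson
  then have "n = 1 * polyg 5 h + 1 * polyg 5 l + 1 * polyg 5 m + 4 * polyg 5 k"
    using four_squares_rep_sum[OF rep] unfolding g by (simp add: power_mult_distrib)
  then show "\<exists>h l m k. n = 1 * polyg 5 h + 1 * polyg 5 l + 1 * polyg 5 m + 4 * polyg 5 k" by blast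
qed simp_all

text \<open>\<open>19 = 1 + 1 + 1 + 16\<close>; residue 3 modulo 8 makes the even entry a multiple
  of 4.\<close>

lemma universal_p5_p5_p5_2p8: "universal4 1 5 1 5 1 5 2 8"
proof (rule universal4I)
  fix n :: int assume "0 \<le> n"
  then have N: "2 \<le> 24 * n + 19" "(24 * n + 19) mod 4 = 3" "(24 * n + 19) mod 3 = 1" "(24 * n + 19) mod 8 = 3"
    by presburger+
  then obtain a b c d where rep: "four_squares_rep (24 * n + 19) a b c d"
    and odd: "odd a" "odd b" "odd c" "even d"
    using ex_four_squares_rep_three_odd by blast
  have dvd: "\<not> 3 dvd a" "\<not> 3 dvd b" "\<not> 3 dvd c" "\<not> 3 dvd d"
    using four_squares_rep_mod_3_1[OF rep N(3)] by blast+
  have "4 dvd d"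
    using three_odd_squares_mod_8[OF odd] N(4) four_squares_rep_sum[OF rep] by (auto split: if_splits)
  then obtain g where g: "d = 4 * g" by (elim dvdE)
  then have "\<not> 3 dvd g" using dvd by presburger
  then obtain h l m k where "a\<^sup>2 = 24 * polyg 5 h + 1" "b\<^sup>2 = 24 * polyg 5 l + 1"
      "c\<^sup>2 = 24 * polyg 5 m + 1" "g\<^sup>2 = 3 * polyg 8 k + 1"
    using ex_polyg_5 ex_polyg_8 odd dvd by meson
  then have "n = 1 * polyg 5 h + 1 * polyg 5 l + 1 * polyg 5 m + 2 * polyg 8 k"
    using four_squares_rep_sum[OF rep] unfolding g by (simp add: power_mult_distrib)
  then show "\<exists>h l m k. n = 1 * polyg 5 h + 1 * polyg 5 l + 1 * polyg 5 m + 2 * polyg 8 k" by blast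
qed simp_all

text \<open>The three odd entries cannot all be divisible by 3, so one coprime to 3 can be singled
  out for a pentagonal number.\<close>

lemma four_squares_three_odd:
  fixes n :: int
  assumes "2 \<le> n" "n mod 4 = 3"
  shows "\<exists>x y a d. n = x\<^sup>2 + y\<^sup>2 + a\<^sup>2 + d\<^sup>2 \<and> odd x \<and> odd y \<and> odd a \<and> even d \<and> \<not> 3 dvd a"
proof -
  obtain a b c d where rep: "four_squares_rep n a b c d" and *: "odd a" "odd b" "odd c" "even d"
    using ex_four_squares_rep_three_odd[OF assms] by blast
  have "n = a\<^sup>2 + b\<^sup>2 + c\<^sup>2 + d\<^sup>2" "n = a\<^sup>2 + c\<^sup>2 + b\<^sup>2 + d\<^sup>2" "n = b\<^sup>2 + c\<^sup>2 + a\<^sup>2 + d\<^sup>2"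
    using four_squares_rep_sum[OF rep] by simp_all
  moreover have "\<not> 3 dvd a \<or> \<not> 3 dvd b \<or> \<not> 3 dvd c" using rep by (auto simp: four_squares_rep_def)
  ultimately show ?thesis using * by blast
qed

lemma universal_p3_p3_2p4_3p5: "universal4 1 3 1 3 2 4 3 5"
proof (rule universal4I)
  fix n :: int assume "0 \<le> n"
  then have N: "2 \<le> 8 * n + 3" "(8 * n + 3) mod 4 = 3" "(8 * n + 3) mod 8 = 3" by presburger+
  then obtain x y a d where eq: "8 * n + 3 = x\<^sup>2 + y\<^sup>2 + a\<^sup>2 + d\<^sup>2"
    and odd: "odd x" "odd y" "odd a" "even d" and "\<not> 3 dvd a"
    using four_squares_three_odd by blast
  have "4 dvd d" using three_odd_squares_mod_8[OF odd] N(3) eq by (auto split: if_splits)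
  then obtain m where m: "d = 4 * m" by (elim dvdE)
  obtain h l k where "x\<^sup>2 = 8 * polyg 3 h + 1" "y\<^sup>2 = 8 * polyg 3 l + 1" "a\<^sup>2 = 24 * polyg 5 k + 1"
    using ex_polyg_3 ex_polyg_5 odd \<open>\<not> 3 dvd a\<close> by meson
  then have "n = 1 * polyg 3 h + 1 * polyg 3 l + 2 * polyg 4 m + 3 * polyg 5 k"
    using eq unfolding m by (simp add: power_mult_distrib polyg_4)
  then show "\<exists>h l m k. n = 1 * polyg 3 h + 1 * polyg 3 l + 2 * polyg 4 m + 3 * polyg 5 k" by blast
qed simp_all

lemma universal_p3_p3_4p3_3p5: "universal4 1 3 1 3 4 3 3 5"
proof (rule universal4I)
  fix n :: int assume "0 \<le> n"
  then have N: "2 \<le> 8 * n + 7" "(8 * n + 7) mod 4 = 3" "(8 * n + 7) mod 8 = 7" by presburger+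
  then obtain x y a d where eq: "8 * n + 7 = x\<^sup>2 + y\<^sup>2 + a\<^sup>2 + d\<^sup>2"
    and odd: "odd x" "odd y" "odd a" "even d" and "\<not> 3 dvd a"
    using four_squares_three_odd by blast
  have "\<not> 4 dvd d" using three_odd_squares_mod_8[OF odd] N(3) eq by (auto split: if_splits)
  obtain g where g: "d = 2 * g" using odd by (elim evenE)
  then have "odd g" using \<open>\<not> 4 dvd d\<close> by presburger
  then obtain h l m k where "x\<^sup>2 = 8 * polyg 3 h + 1" "y\<^sup>2 = 8 * polyg 3 l + 1"
      "g\<^sup>2 = 8 * polyg 3 m + 1" "a\<^sup>2 = 24 * polyg 5 k + 1"
    using ex_polyg_3 ex_polyg_5 odd \<open>\<not> 3 dvd a\<close> by meson
  then have "n = 1 * polyg 3 h + 1 * polyg 3 l + 4 * polyg 3 m + 3 * polyg 5 k"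
    using eq unfolding g by (simp add: power_mult_distrib)
  then show "\<exists>h l m k. n = 1 * polyg 3 h + 1 * polyg 3 l + 4 * polyg 3 m + 3 * polyg 5 k" by blast
qed simp_all

section \<open>Sums using the form \<open>u\<^sup>2 + 2 * v\<^sup>2\<close>\<close>

text \<open>Normalising signs makes differences of odd entries divisible by 4 and half-sums
  odd.\<close>

lemma ex_square_eq_mod_4_1:
  fixes a :: int
  assumes "odd a"
  shows "\<exists>b. b\<^sup>2 = a\<^sup>2 \<and> b mod 4 = 1 \<and> (3 dvd b \<longleftrightarrow> 3 dvd a)"
proof -
  have "a mod 4 = 1 \<or> (- a) mod 4 = 1" using assms by presburger
  then show ?thesis by (metis power2_minus dvd_minus_iff)
qed

text \<open>
  Since 3 is a norm from \<open>\<int>[\<surd>-2]\<close>, we have \<open>3 (u\<^sup>2 + 2 v\<^sup>2) = 2 (u + v)\<^sup>2 + (u - 2 v)\<^sup>2\<close>; both squares on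
  the right are coprime to 3 as soon as \<open>u + v\<close> is.
\<close>
lemma ex_sum_8_2_squares:
  fixes n :: int
  assumes "2 \<le> n" "n mod 4 = 3"
  shows "\<exists>b x v u. n = b\<^sup>2 + 8 * x\<^sup>2 + 2 * v\<^sup>2 + u\<^sup>2 \<and> odd b \<and> odd v \<and> even u \<and>
    \<not> 3 dvd b \<and> \<not> 3 dvd u + v \<and> n mod 8 = (if 4 dvd u then 3 else 7)"
proof -
  obtain a1 b1 c1 d where rep: "four_squares_rep n a1 b1 c1 d"
    and odd: "odd a1" "odd b1" "odd c1" "even d"
    using ex_four_squares_rep_three_odd[OF assms] by blast
  obtain a b c where abc: "a\<^sup>2 = a1\<^sup>2" "b\<^sup>2 = b1\<^sup>2" "c\<^sup>2 = c1\<^sup>2"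
    and m: "a mod 4 = 1" "b mod 4 = 1" "c mod 4 = 1"
    and dvd: "3 dvd a \<longleftrightarrow> 3 dvd a1" "3 dvd b \<longleftrightarrow> 3 dvd b1" "3 dvd c \<longleftrightarrow> 3 dvd c1"
    using ex_square_eq_mod_4_1 odd by metis
  have sums: "n = a\<^sup>2 + b\<^sup>2 + c\<^sup>2 + d\<^sup>2" "n = b\<^sup>2 + a\<^sup>2 + c\<^sup>2 + d\<^sup>2" "n = c\<^sup>2 + a\<^sup>2 + b\<^sup>2 + d\<^sup>2"
    using four_squares_rep_sum[OF rep] abc by simp_all
  have two: "\<not> (3 dvd a \<and> 3 dvd b \<and> 3 dvd c)" "\<not> (3 dvd a \<and> 3 dvd b \<and> 3 dvd d)"
    "\<not> (3 dvd a \<and> 3 dvd c \<and> 3 dvd d)" "\<not> (3 dvd b \<and> 3 dvd c \<and> 3 dvd d)"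
    using rep dvd unfolding four_squares_rep_def by blast+
  \<comment> \<open>If \<open>3 dvd d\<close>, at most one of \<open>a\<close>, \<open>b\<close>,
    \<open>c\<close> is divisible by 3. Either it is paired with a coprime entry, or all three are
    coprime and two congruent ones are paired; both sums are coprime to 3.\<close>
  have "\<not> 3 dvd a \<and> (3 dvd d \<longrightarrow> \<not> 3 dvd b + c) \<or> \<not> 3 dvd b \<and> (3 dvd d \<longrightarrow> \<not> 3 dvd a + c) \<or>
      \<not> 3 dvd c \<and> (3 dvd d \<longrightarrow> \<not> 3 dvd a + b)"
    using two by presburger
  then obtain r p q where n: "n = r\<^sup>2 + p\<^sup>2 + q\<^sup>2 + d\<^sup>2"
    and m: "r mod 4 = 1" "p mod 4 = 1" "q mod 4 = 1"
    and r: "\<not> 3 dvd r" "3 dvd d \<longrightarrow> \<not> 3 dvd p + q"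
    using sums m by metis
  have "4 dvd p - q" "2 dvd p + q" using m by presburger+
  then obtain x v where x: "p - q = 4 * x" and v: "p + q = 2 * v" by (elim dvdE)
  \<comment> \<open>Were both divisible by 3, then so would be \<open>d\<close> and
    \<open>v\<close>, and hence \<open>p + q\<close>, against the choice of the pair.\<close>
  have "\<not> 3 dvd d + v \<or> \<not> 3 dvd - d + v" using v r(2) by presburger
  then obtain u where u: "u\<^sup>2 = d\<^sup>2" "even u" "\<not> 3 dvd u + v" using odd(4) by (metis even_minus power2_minus)
  have pq: "p = v + 2 * x" "q = v - 2 * x" using x v by linarith+
  have "p\<^sup>2 + q\<^sup>2 = 8 * x\<^sup>2 + 2 * v\<^sup>2" unfolding pq by (simp add: power2_eq_square algebra_simps)
  then have "n = r\<^sup>2 + 8 * x\<^sup>2 + 2 * v\<^sup>2 + u\<^sup>2" using n u by simp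
  moreover have "odd r" "odd p" "odd q" "odd v" using m v by presburger+
  moreover have "n mod 8 = (if 4 dvd u then 3 else 7)"
    using three_odd_squares_mod_8[OF \<open>odd r\<close> \<open>odd p\<close> \<open>odd q\<close> u(2)] n u(1) by simp
  ultimately show ?thesis using u r by blast
qed

lemma universal_p4_2p5_3p5_4p5: "universal4 1 4 2 5 3 5 4 5"
proof (rule universal4I)
  fix n :: int assume "0 \<le> n"
  then have N: "2 \<le> 8 * n + 3" "(8 * n + 3) mod 4 = 3" "(8 * n + 3) mod 8 = 3" by presburger+
  then obtain b x v u where eq: "8 * n + 3 = b\<^sup>2 + 8 * x\<^sup>2 + 2 * v\<^sup>2 + u\<^sup>2"
    and *: "odd b" "odd v" "even u" "\<not> 3 dvd b" "\<not> 3 dvd u + v"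
    and "(8 * n + 3) mod 8 = (if 4 dvd u then 3 else 7)"
    using ex_sum_8_2_squares by blast
  then have "4 dvd u" using N(3) by (auto split: if_splits)
  then obtain g where g: "u = 4 * g" by (elim dvdE)
  \<comment> \<open>\<open>2 * g - v\<close> is half of \<open>u - 2 * v\<close>, which is congruent
    to \<open>u + v\<close> modulo 3.\<close>
  have "odd (u + v)" "odd (2 * g - v)" "\<not> 3 dvd 2 * g - v" using * g by presburger+
  then obtain l m k where lk: "(u + v)\<^sup>2 = 24 * polyg 5 l + 1" "b\<^sup>2 = 24 * polyg 5 m + 1"
      "(2 * g - v)\<^sup>2 = 24 * polyg 5 k + 1"
    using ex_polyg_5 * by meson
  have "3 * (2 * v\<^sup>2 + u\<^sup>2) = 2 * (u + v)\<^sup>2 + 4 * (2 * g - v)\<^sup>2"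
    unfolding g by (simp add: power2_eq_square algebra_simps)
  then have "n = 1 * polyg 4 x + 2 * polyg 5 l + 3 * polyg 5 m + 4 * polyg 5 k"
    using eq unfolding polyg_4 lk by simp
  then show "\<exists>h l m k. n = 1 * polyg 4 h + 2 * polyg 5 l + 3 * polyg 5 m + 4 * polyg 5 k" by blast
qed simp_all

lemma universal_p4_2p5_3p5_2p8: "universal4 1 4 2 5 3 5 2 8"
proof (rule universal4I)
  fix n :: int assume "0 \<le> n"
  then have N: "2 \<le> 8 * n + 7" "(8 * n + 7) mod 4 = 3" "(8 * n + 7) mod 8 = 7" by presburger+
  then obtain b x v u where eq: "8 * n + 7 = b\<^sup>2 + 8 * x\<^sup>2 + 2 * v\<^sup>2 + u\<^sup>2"
    and *: "odd b" "odd v" "even u" "\<not> 3 dvd b" "\<not> 3 dvd u + v"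
    and "(8 * n + 7) mod 8 = (if 4 dvd u then 3 else 7)"
    using ex_sum_8_2_squares by blast
  then have "\<not> 4 dvd u" using N(3) by (auto split: if_splits)
  \<comment> \<open>Both \<open>u\<close> and \<open>2 * v\<close> are 2 modulo 4, so the square of
    \<open>u - 2 * v\<close> yields \<open>16 * g\<^sup>2\<close>, as an octagonal term
    requires.\<close>
  then have "4 dvd u - 2 * v" using * by presburger
  then obtain g where g: "u - 2 * v = 4 * g" by (elim dvdE)
  have "odd (u + v)" "\<not> 3 dvd g" using * g by presburger+
  then obtain l m k where lk: "(u + v)\<^sup>2 = 24 * polyg 5 l + 1" "b\<^sup>2 = 24 * polyg 5 m + 1"
      "g\<^sup>2 = 3 * polyg 8 k + 1"
    using ex_polyg_5 ex_polyg_8 * by meson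
  have "3 * (2 * v\<^sup>2 + u\<^sup>2) = 2 * (u + v)\<^sup>2 + (u - 2 * v)\<^sup>2"
    by (simp add: power2_eq_square algebra_simps)
  then have "3 * (2 * v\<^sup>2 + u\<^sup>2) = 2 * (u + v)\<^sup>2 + 16 * g\<^sup>2"
    unfolding g by (simp add: power_mult_distrib)
  then have "n = 1 * polyg 4 x + 2 * polyg 5 l + 3 * polyg 5 m + 2 * polyg 8 k"
    using eq unfolding polyg_4 lk by simp
  then show "\<exists>h l m k. n = 1 * polyg 4 h + 2 * polyg 5 l + 3 * polyg 5 m + 2 * polyg 8 k" by blast
qed simp_all

section \<open>Two further sums read off modulo 12\<close>

text \<open>Scaling by 12 adds \<open>1 + 1 + 1 + 4 = 7\<close>, and residue 3 modulo 4 gives three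
  odd entries.\<close>

lemma universal_2p5_2p5_2p5_p8: "universal4 2 5 2 5 2 5 1 8"
proof (rule universal4I)
  fix n :: int assume "0 \<le> n"
  then have "2 \<le> 12 * n + 7" "(12 * n + 7) mod 4 = 3" "(12 * n + 7) mod 3 = 1" by presburger+
  then obtain a b c d where rep: "four_squares_rep (12 * n + 7) a b c (2 * d)" "odd a" "odd b" "odd c"
    by (metis ex_four_squares_rep_three_odd evenE)
  then have "\<not> 3 dvd a" "\<not> 3 dvd b" "\<not> 3 dvd c" "\<not> 3 dvd d"
    using four_squares_rep_mod_3_1 \<open>(12 * n + 7) mod 3 = 1\<close> by (meson dvd_mult)+
  then obtain h l m k where "a\<^sup>2 = 24 * polyg 5 h + 1" "b\<^sup>2 = 24 * polyg 5 l + 1"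
      "c\<^sup>2 = 24 * polyg 5 m + 1" "d\<^sup>2 = 3 * polyg 8 k + 1"
    using ex_polyg_5 ex_polyg_8 rep(2-4) by meson
  then have "n = 2 * polyg 5 h + 2 * polyg 5 l + 2 * polyg 5 m + 1 * polyg 8 k"
    using four_squares_rep_sum[OF rep(1)] by (simp add: power_mult_distrib)
  then show "\<exists>h l m k. n = 2 * polyg 5 h + 2 * polyg 5 l + 2 * polyg 5 m + 1 * polyg 8 k" by blast
qed simp_all

text \<open>Scaling by 12 adds \<open>1 + 4 + 4 + 4 = 13\<close>, and residue 1 modulo 4 gives one
  odd entry.\<close>

lemma universal_2p5_p8_p8_p8: "universal4 2 5 1 8 1 8 1 8"
proof (rule universal4I)
  fix n :: int assume "0 \<le> n"
  then have "2 \<le> 12 * n + 13" "(12 * n + 13) mod 4 = 1" "(12 * n + 13) mod 3 = 1" by presburger+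
  then obtain a b c d where rep: "four_squares_rep (12 * n + 13) a (2 * b) (2 * c) (2 * d)" "odd a"
    by (metis ex_four_squares_rep_one_odd evenE)
  then have "\<not> 3 dvd a" "\<not> 3 dvd b" "\<not> 3 dvd c" "\<not> 3 dvd d"
    using four_squares_rep_mod_3_1 \<open>(12 * n + 13) mod 3 = 1\<close> by (meson dvd_mult)+
  then obtain h l m k where "a\<^sup>2 = 24 * polyg 5 h + 1" "b\<^sup>2 = 3 * polyg 8 l + 1"
      "c\<^sup>2 = 3 * polyg 8 m + 1" "d\<^sup>2 = 3 * polyg 8 k + 1"
    using ex_polyg_5 ex_polyg_8 rep(2) by meson
  then have "n = 2 * polyg 5 h + 1 * polyg 8 l + 1 * polyg 8 m + 1 * polyg 8 k"
    using four_squares_rep_sum[OF rep(1)] by (simp add: power_mult_distrib)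
  then show "\<exists>h l m k. n = 2 * polyg 5 h + 1 * polyg 8 l + 1 * polyg 8 m + 1 * polyg 8 k" by blast
qed simp_all

theorem theorem3p3:
  shows "universal4 2 5 2 5 1 8 1 8 \<and>
         universal4 1 8 1 8 1 8 1 8 \<and>
         universal4 3 4 3 4 1 8 1 8 \<and>
         universal4 6 3 3 4 2 5 1 8 \<and>
         universal4 3 3 1 5 2 5 2 5 \<and>
         universal4 3 3 1 5 1 8 1 8 \<and>
         universal4 3 4 1 5 1 5 1 8 \<and>
         universal4 6 3 1 5 1 5 2 5 \<and>
         universal4 1 5 1 5 1 5 4 5 \<and>
         universal4 1 5 1 5 1 5 2 8 \<and>
         universal4 1 3 1 3 2 4 3 5 \<and>
         universal4 1 3 1 3 4 3 3 5 \<and>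
         universal4 1 4 2 5 3 5 4 5 \<and>
         universal4 1 4 2 5 3 5 2 8 \<and>
         universal4 2 5 2 5 2 5 1 8 \<and>
         universal4 2 5 1 8 1 8 1 8"
  by (intro conjI universal_2p5_2p5_p8_p8 universal_p8_p8_p8_p8 universal_3p4_3p4_p8_p8
      universal_6p3_3p4_2p5_p8 universal_3p3_p5_2p5_2p5 universal_3p3_p5_p8_p8
      universal_3p4_p5_p5_p8 universal_6p3_p5_p5_2p5 universal_p5_p5_p5_4p5
      universal_p5_p5_p5_2p8 universal_p3_p3_2p4_3p5 universal_p3_p3_4p3_3p5
      universal_p4_2p5_3p5_4p5 universal_p4_2p5_3p5_2p8 universal_2p5_2p5_2p5_p8
      universal_2p5_p8_p8_p8)

end
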